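(* Let $X$ be a Banach space such that $\epsilon_0(X)<1$, and let $K\subset X$ be a nonempty, closed, bounded, and convex subset. Then every asymptotically Hölder nonexpansive mapping $T\colon K\to K$ possesses a fixed point.
   Context: The modulus of convexity of a Banach space $X$ is $\delta_X\colon[0,2]\to[0,1]$, $\delta_X(\epsilon)=\inf\{1-\|\frac{x+y}{2}\| : \|x\|\le 1,\ \|y\|\le 1,\ \|x-y\|\ge\epsilon\}$. The characteristic of convexity of $X$ is $\epsilon_0(X)=\sup\{\epsilon\in[0,2]:\delta_X(\epsilon)=0\}$. Let $K$ be a nonempty subset of $X$. A mapping $T\colon K\to K$ is asymptotically Hölder nonexpansive if there exist sequences $(\alpha_n)\subset(0,1]$ and $(\varepsilon_n)\subset[0,\infty)$ such that $\alpha_n\to1$, $\varepsilon_n\to0$, and $\|T^n x-T^n y\|\le(1+\varepsilon_n)\|x-y\|^{\alpha_n}$ for all $x,y\in K$ and $n\ge1$, where $T^n$ is the $n$-th iterate of $T$. *)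

theory Defs
  imports "HOL-Analysis.Analysis"
begin

text \<open>The Banach space is a type of class \<^class>\<open>banach\<close>, so the two geometric constants below
  take that type as an argument.\<close>

text \<open>The infimum is taken in the codomain \<open>[0,1]\<close>, where the infimum of the empty set is \<open>1\<close>.
  Since \<open>1 - norm v \<le> 1\<close> always, inserting \<open>1\<close> changes nothing when the set is nonempty.
  It can be empty for \<open>\<epsilon> \<in> [0,2]\<close> only in the zero space.\<close>

definition modulus_of_convexity :: "'a::real_normed_vector itself \<Rightarrow> real \<Rightarrow> real" where
  "modulus_of_convexity _ \<epsilon> =
     Inf (insert 1 {1 - norm ((x + y) /\<^sub>R 2) | x y :: 'a.
                      norm x \<le> 1 \<and> norm y \<le> 1 \<and> norm (x - y) \<ge> \<epsilon>})"

text \<open>Likewise the supremum is taken in \<open>[0,2]\<close>, where the supremum of the empty set is \<open>0\<close>.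
  In a nonzero space the modulus vanishes at \<open>0\<close> and the inserted \<open>0\<close> is redundant;
  in the zero space the modulus is constantly \<open>1\<close> on \<open>[0,2]\<close>.\<close>

definition characteristic_of_convexity :: "'a::real_normed_vector itself \<Rightarrow> real" where
  "characteristic_of_convexity X =
     Sup (insert 0 {\<epsilon> \<in> {0..2}. modulus_of_convexity X \<epsilon> = 0})"

text \<open>The sequences are indexed by \<open>n \<ge> 1\<close>, so their values at \<open>0\<close> are unconstrained.
  For \<open>x = y\<close> the bound is \<open>0\<close>, because \<open>0 powr a = 0\<close>.\<close>

definition asymptotically_hoelder_nonexpansive_on ::
    "'a::real_normed_vector set \<Rightarrow> ('a \<Rightarrow> 'a) \<Rightarrow> bool" where
  "asymptotically_hoelder_nonexpansive_on K T \<longleftrightarrow>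
     (\<exists>\<alpha> \<epsilon> :: nat \<Rightarrow> real.
        (\<forall>n\<ge>1. 0 < \<alpha> n \<and> \<alpha> n \<le> 1) \<and> (\<forall>n\<ge>1. 0 \<le> \<epsilon> n) \<and>
        \<alpha> \<longlonglongrightarrow> 1 \<and> \<epsilon> \<longlonglongrightarrow> 0 \<and>
        (\<forall>n\<ge>1. \<forall>x\<in>K. \<forall>y\<in>K.
           norm ((T ^^ n) x - (T ^^ n) y) \<le> (1 + \<epsilon> n) * norm (x - y) powr \<alpha> n))"

end

theory Submission
  imports Defs
begin

text \<open>Write \<open>d x\<close> for the upper limit of \<open>norm (T\<^sup>n x - x)\<close>. The proof finds points where \<open>d\<close> decreases
  geometrically and passes to the limit.

  Fix \<open>c < q < 1\<close> with \<open>c\<close> above the characteristic of convexity, so that two points of a ball of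
  radius \<open>s\<close> at distance at least \<open>c * s\<close> have their midpoint in the concentric ball of radius
  \<open>(1 - \<delta>) * s\<close>, for some \<open>\<delta> > 0\<close> independent of \<open>s\<close> (\<open>uniform_midpoint_contraction\<close>). Given \<open>x\<close>, let
  \<open>\<rho>\<close> be the asymptotic radius of its orbit, the infimum over \<open>y \<in> K\<close> of the upper limit of
  \<open>norm (T\<^sup>i x - y)\<close>; taking \<open>y = x\<close> shows \<open>\<rho> \<le> d x\<close>. Let \<open>z \<in> K\<close> nearly attain \<open>\<rho>\<close>. Since \<open>T\<^sup>n\<close> hardly
  increases distances when \<open>n\<close> is large, \<open>T\<^sup>n z\<close> nearly attains \<open>\<rho>\<close> as well. The midpoint of \<open>z\<close> and
  \<open>T\<^sup>n z\<close> lies in \<open>K\<close> and cannot do better than \<open>\<rho>\<close>, so \<open>z\<close> and \<open>T\<^sup>n z\<close> are at distance little more than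
  \<open>c * \<rho>\<close>. Hence \<open>d z \<le> q * d x\<close>, while \<open>norm (z - x) \<le> 3 * d x\<close> (\<open>asymptotic_displacement_reduction\<close>).

  Iterating gives a Cauchy sequence. Asymptotic nonexpansiveness gives
  \<open>d w \<le> d y + 2 * norm (w - y)\<close>, so \<open>d\<close> vanishes at its limit \<open>w\<close>. Thus \<open>T\<^sup>n w\<close> converges to \<open>w\<close>,
  and \<open>T w = w\<close> because \<open>T\<close> is continuous. Because only near minimizers of the asymptotic radius are
  used, no reflexivity of the space enters.\<close>

section \<open>Modulus and characteristic of convexity\<close>

lemma midpoint_deficit_nonneg:
  fixes x y :: "'a::real_normed_vector"
  assumes "norm x \<le> 1" "norm y \<le> 1"
  shows "0 \<le> 1 - norm ((x + y) /\<^sub>R 2)"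
  using norm_triangle_ineq[of x y] assms by simp

lemma modulus_of_convexity_le:
  fixes x y :: "'a::real_normed_vector"
  assumes "norm x \<le> 1" "norm y \<le> 1" "norm (x - y) \<ge> e"
  shows "modulus_of_convexity TYPE('a) e \<le> 1 - norm ((x + y) /\<^sub>R 2)"
  unfolding modulus_of_convexity_def
proof (rule cInf_lower)
  show "bdd_below (insert 1 {1 - norm ((x + y) /\<^sub>R 2) | x y :: 'a.
      norm x \<le> 1 \<and> norm y \<le> 1 \<and> norm (x - y) \<ge> e})"
    unfolding bdd_below_insert
    by (rule bdd_belowI[where m = 0]) (use midpoint_deficit_nonneg in blast)
qed (use assms in blast)

lemma modulus_of_convexity_nonneg: "0 \<le> modulus_of_convexity TYPE('a::real_normed_vector) e"
  unfolding modulus_of_convexity_def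
proof (rule cInf_greatest)
  fix t assume "t \<in> insert 1 {1 - norm ((x + y) /\<^sub>R 2) | x y :: 'a.
    norm x \<le> 1 \<and> norm y \<le> 1 \<and> norm (x - y) \<ge> e}"
  then show "0 \<le> t" using midpoint_deficit_nonneg zero_le_one by blast
qed simp

lemma characteristic_of_convexity_bounds:
  shows characteristic_of_convexity_nonneg:
      "0 \<le> characteristic_of_convexity TYPE('a::real_normed_vector)"
    and characteristic_of_convexity_upper:
      "\<lbrakk>e \<in> {0..2}; modulus_of_convexity TYPE('a) e = 0\<rbrakk>
        \<Longrightarrow> e \<le> characteristic_of_convexity TYPE('a)"
proof -
  have "bdd_above (insert 0 {e \<in> {0..2}. modulus_of_convexity TYPE('a) e = 0})"
    by (rule bdd_aboveI[where M = 2]) auto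
  then show "0 \<le> characteristic_of_convexity TYPE('a)"
    "\<lbrakk>e \<in> {0..2}; modulus_of_convexity TYPE('a) e = 0\<rbrakk>
      \<Longrightarrow> e \<le> characteristic_of_convexity TYPE('a)"
    unfolding characteristic_of_convexity_def by (auto intro: cSup_upper)
qed

text \<open>Above its characteristic the modulus is positive, and its value there serves as \<open>\<delta>\<close>; the bound
  for balls of arbitrary radius follows by scaling.\<close>

lemma uniform_midpoint_contraction:
  assumes "characteristic_of_convexity TYPE('a::real_normed_vector) < c" "c \<le> 2"
  obtains \<delta> where "\<delta> > 0"
    "\<And>(a::'a) b s. \<lbrakk>s > 0; norm a \<le> s; norm b \<le> s; norm (a - b) \<ge> c * s\<rbrakk>
        \<Longrightarrow> norm ((a + b) /\<^sub>R 2) \<le> (1 - \<delta>) * s"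
proof
  let ?\<delta> = "modulus_of_convexity TYPE('a) c"
  show "?\<delta> > 0"
    using characteristic_of_convexity_nonneg[where 'a='a]
      characteristic_of_convexity_upper[where 'a='a, of c]
      modulus_of_convexity_nonneg[where 'a='a, of c] assms by force
  fix a b :: 'a and s :: real
  assume s: "s > 0" "norm a \<le> s" "norm b \<le> s" "norm (a - b) \<ge> c * s"
  have "norm (a /\<^sub>R s) \<le> 1" "norm (b /\<^sub>R s) \<le> 1" "norm (a /\<^sub>R s - b /\<^sub>R s) \<ge> c"
    using s by (simp_all add: divide_simps mult.commute
        flip: scaleR_diff_right divide_inverse_commute)
  then have "?\<delta> \<le> 1 - norm ((a /\<^sub>R s + b /\<^sub>R s) /\<^sub>R 2)"
    by (rule modulus_of_convexity_le)
  also have "(a /\<^sub>R s + b /\<^sub>R s) /\<^sub>R 2 = ((a + b) /\<^sub>R 2) /\<^sub>R s"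
    by (simp add: algebra_simps)
  also have "norm (((a + b) /\<^sub>R 2) /\<^sub>R s) = norm ((a + b) /\<^sub>R 2) / s"
    using s(1) by (simp only: norm_scaleR divide_inverse_commute abs_of_pos positive_imp_inverse_positive)
  finally have "norm ((a + b) /\<^sub>R 2) / s \<le> 1 - ?\<delta>" by linarith
  then show "norm ((a + b) /\<^sub>R 2) \<le> (1 - ?\<delta>) * s"
    using s(1) by (simp only: pos_divide_le_eq)
qed

section \<open>Asymptotically Hoelder nonexpansive maps\<close>

text \<open>The bound \<open>(1 + \<epsilon>\<^sub>n) * s powr \<alpha>\<^sub>n\<close> converges to \<open>s\<close> for each \<open>s > 0\<close>. Apart from continuity, this
  is the only consequence of the Hoelder condition that the fixed point argument needs.\<close>

lemma asymptotically_hoelder_nonexpansive_on_eventually_le: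
  assumes "asymptotically_hoelder_nonexpansive_on K T" "0 < s" "s < t"
  shows "\<forall>\<^sub>F n in sequentially. \<forall>x\<in>K. \<forall>y\<in>K.
    norm (x - y) \<le> s \<longrightarrow> norm ((T ^^ n) x - (T ^^ n) y) \<le> t"
proof -
  obtain \<alpha> \<epsilon> :: "nat \<Rightarrow> real" where
    pos: "\<And>n. n \<ge> 1 \<Longrightarrow> 0 < \<alpha> n" "\<And>n. n \<ge> 1 \<Longrightarrow> 0 \<le> \<epsilon> n"
    and lim: "\<alpha> \<longlonglongrightarrow> 1" "\<epsilon> \<longlonglongrightarrow> 0"
    and bound: "\<And>n x y. \<lbrakk>n \<ge> 1; x \<in> K; y \<in> K\<rbrakk> \<Longrightarrow>
      norm ((T ^^ n) x - (T ^^ n) y) \<le> (1 + \<epsilon> n) * norm (x - y) powr \<alpha> n"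
    using assms(1) unfolding asymptotically_hoelder_nonexpansive_on_def by blast
  have "(\<lambda>n. (1 + \<epsilon> n) * s powr \<alpha> n) \<longlonglongrightarrow> (1 + 0) * s powr 1"
    using \<open>0 < s\<close> by (intro tendsto_intros lim) auto
  then have "(\<lambda>n. (1 + \<epsilon> n) * s powr \<alpha> n) \<longlonglongrightarrow> s" using \<open>0 < s\<close> by simp
  then have "\<forall>\<^sub>F n in sequentially. (1 + \<epsilon> n) * s powr \<alpha> n < t"
    using \<open>s < t\<close> by (rule order_tendstoD)
  then show ?thesis using eventually_ge_at_top[of 1]
  proof eventually_elim
    case (elim n)
    show ?case
    proof (intro ballI impI)
      fix x y assume xy: "x \<in> K" "y \<in> K" "norm (x - y) \<le> s"
      have "norm ((T ^^ n) x - (T ^^ n) y) \<le> (1 + \<epsilon> n) * norm (x - y) powr \<alpha> n"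
        using bound elim(2) xy by blast
      also have "\<dots> \<le> (1 + \<epsilon> n) * s powr \<alpha> n"
        using pos[of n] elim(2) xy by (intro mult_left_mono powr_mono2) auto
      finally show "norm ((T ^^ n) x - (T ^^ n) y) \<le> t" using elim(1) by linarith
    qed
  qed
qed

lemma asymptotically_hoelder_nonexpansive_on_continuous:
  assumes "asymptotically_hoelder_nonexpansive_on K T"
  shows "continuous_on K T"
proof -
  obtain \<alpha> \<epsilon> :: "nat \<Rightarrow> real" where \<alpha>: "0 < \<alpha> 1"
    and bound: "\<And>n x y. \<lbrakk>n \<ge> 1; x \<in> K; y \<in> K\<rbrakk> \<Longrightarrow>
      norm ((T ^^ n) x - (T ^^ n) y) \<le> (1 + \<epsilon> n) * norm (x - y) powr \<alpha> n"
    using assms unfolding asymptotically_hoelder_nonexpansive_on_def by blast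
  show ?thesis unfolding continuous_on_def
  proof
    fix x assume x: "x \<in> K"
    have "((\<lambda>y. (1 + \<epsilon> 1) * norm (y - x) powr \<alpha> 1) \<longlongrightarrow> (1 + \<epsilon> 1) * norm (x - x) powr \<alpha> 1) (at x within K)"
      using \<alpha> by (intro tendsto_intros tendsto_powr') auto
    then have lim: "((\<lambda>y. (1 + \<epsilon> 1) * norm (y - x) powr \<alpha> 1) \<longlongrightarrow> 0) (at x within K)" by simp
    have "\<forall>\<^sub>F y in at x within K. norm (T y - T x) \<le> (1 + \<epsilon> 1) * norm (y - x) powr \<alpha> 1"
      using bound[of 1 _ x] x by (auto simp: eventually_at_filter)
    then have "((\<lambda>y. T y - T x) \<longlongrightarrow> 0) (at x within K)"
      using lim by (rule Lim_null_comparison)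
    then show "(T \<longlongrightarrow> T x) (at x within K)" by (rule LIM_zero_cancel)
  qed
qed

section \<open>Reducing the asymptotic displacement\<close>

text \<open>The displacement bound \<open>d\<close> shrinks by a factor \<open>q\<close> when \<open>x\<close> is replaced by a near minimizer of
  the asymptotic radius of its orbit. Besides invariance of \<open>K\<close>, only \<open>near\<close> is used of the map: for large \<open>n\<close>, \<open>T\<^sup>n\<close> sends pairs
  of points at distance at most \<open>s\<close> to pairs at distance at most \<open>t\<close>, for any given \<open>t > s\<close>.\<close>

lemma asymptotic_displacement_reduction:
  fixes K :: "'a::real_normed_vector set"
  assumes char: "characteristic_of_convexity TYPE('a) < c" and cq: "c < q" and q: "q < 1"
    and K: "convex K" "T \<in> K \<rightarrow> K"
    and near: "\<And>s t. \<lbrakk>0 < s; s < t\<rbrakk> \<Longrightarrow> \<forall>\<^sub>F n in sequentially. \<forall>x\<in>K. \<forall>y\<in>K.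
        norm (x - y) \<le> s \<longrightarrow> norm ((T ^^ n) x - (T ^^ n) y) \<le> t"
    and x: "x \<in> K" and d: "d > 0" "\<forall>\<^sub>F n in sequentially. norm ((T ^^ n) x - x) \<le> d"
  shows "\<exists>z\<in>K. (\<forall>\<^sub>F n in sequentially. norm ((T ^^ n) z - z) \<le> q * d) \<and> norm (z - x) \<le> 3 * d"
proof -
  have c: "0 < c"
    using characteristic_of_convexity_nonneg[where 'a='a] char by linarith
  obtain \<delta> where \<delta>: "\<delta> > 0"
    and mid: "\<And>(a::'a) b s. \<lbrakk>s > 0; norm a \<le> s; norm b \<le> s; norm (a - b) \<ge> c * s\<rbrakk>
        \<Longrightarrow> norm ((a + b) /\<^sub>R 2) \<le> (1 - \<delta>) * s"
    using uniform_midpoint_contraction[OF char] cq q by auto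
  have TK: "(T ^^ n) y \<in> K" if "y \<in> K" for n y
    using that K(2) by (induction n) auto
  \<comment> \<open>The infimum of \<open>R\<close> is the asymptotic radius of the orbit of \<open>x\<close>.\<close>
  define R where "R = {r. \<exists>y\<in>K. \<forall>\<^sub>F i in sequentially. norm ((T ^^ i) x - y) \<le> r}"
  define \<rho> where "\<rho> = Inf R"
  have R_nonneg: "0 \<le> r" if rR: "r \<in> R" for r
  proof -
    obtain y where "\<forall>\<^sub>F i in sequentially. norm ((T ^^ i) x - y) \<le> r"
      using rR unfolding R_def by blast
    then obtain i where "norm ((T ^^ i) x - y) \<le> r"
      unfolding eventually_sequentially by blast
    then show ?thesis using norm_ge_zero order_trans by blast
  qed
  have R_lower: "\<rho> \<le> r" if "r \<in> R" for r
    unfolding \<rho>_def by (rule cInf_lower[OF that bdd_belowI[of R 0]]) (rule R_nonneg)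
  have dR: "d \<in> R" using x d unfolding R_def by blast
  have \<rho>: "0 \<le> \<rho>" "\<rho> \<le> d"
  proof -
    show "0 \<le> \<rho>" unfolding \<rho>_def using dR R_nonneg by (intro cInf_greatest) auto
  qed (rule R_lower[OF dR])
  \<comment> \<open>A radius just above \<open>\<rho>\<close> works if \<open>\<rho> > 0\<close>. If \<open>\<rho> = 0\<close>, the midpoint argument has no content,
    and a radius so small that the triangle inequality suffices is used instead.\<close>
  obtain s where s: "\<rho> < s" "c * s \<le> q * d" "(1 - \<delta>) * s < \<rho> \<or> 2 * s \<le> q * d"
  proof (cases "\<rho> = 0")
    case True
    have "c * (q * d / 2) \<le> 1 * (q * d / 2)"
      using c cq q d(1) by (intro mult_right_mono) auto
    moreover have "0 < q * d" using c cq d(1) by simp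
    ultimately show ?thesis using True by (intro that[of "q * d / 2"]) auto
  next
    case False
    then have "\<rho> > 0" using \<rho> by simp
    have "c * \<rho> < q * \<rho>" using cq \<open>\<rho> > 0\<close> by simp
    also have "\<dots> \<le> q * d" using \<rho> c cq by simp
    finally have 1: "c * \<rho> < q * d" .
    have 2: "(1 - \<delta>) * \<rho> < \<rho>" using \<delta> \<open>\<rho> > 0\<close> by (simp add: algebra_simps)
    have "\<forall>\<^sub>F s in at_right \<rho>. c * s < q * d"
      by (rule order_tendstoD(2)[OF _ 1]) (intro tendsto_intros)
    moreover have "\<forall>\<^sub>F s in at_right \<rho>. (1 - \<delta>) * s < \<rho>"
      by (rule order_tendstoD(2)[OF _ 2]) (intro tendsto_intros)
    moreover have "\<forall>\<^sub>F s in at_right \<rho>. \<rho> < s" by (rule eventually_at_right_less)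
    ultimately have "\<forall>\<^sub>F s in at_right \<rho>. c * s < q * d \<and> (1 - \<delta>) * s < \<rho> \<and> \<rho> < s"
      by eventually_elim simp
    then obtain s where "c * s < q * d \<and> (1 - \<delta>) * s < \<rho> \<and> \<rho> < s"
      using eventually_happens'[OF trivial_limit_at_right_real] by blast
    then show ?thesis by (intro that) auto
  qed
  have "\<rho> < min s (2 * d)" using s(1) \<rho> d(1) by auto
  then obtain r where r: "\<rho> < r" "r < s" "r < 2 * d"
    using dense[of \<rho> "min s (2 * d)"] by auto
  obtain r' where "r' \<in> R" "r' < r"
    using cInf_lessD[of R r] dR r(1) unfolding \<rho>_def by auto
  then obtain z where z: "z \<in> K" "\<forall>\<^sub>F i in sequentially. norm ((T ^^ i) x - z) \<le> r'"
    unfolding R_def by blast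
  have zr: "\<forall>\<^sub>F i in sequentially. norm ((T ^^ i) x - z) \<le> r"
    using z(2) by eventually_elim (use \<open>r' < r\<close> in linarith)
  have "\<forall>\<^sub>F i in sequentially. norm (z - x) \<le> 3 * d"
    using zr d(2)
  proof eventually_elim
    case (elim i)
    show ?case
      using norm_triangle_ineq4[of "(T ^^ i) x - x" "(T ^^ i) x - z"] elim r(3) by simp
  qed
  then have zx: "norm (z - x) \<le> 3 * d" by simp
  have "\<forall>\<^sub>F n in sequentially. \<forall>x\<in>K. \<forall>y\<in>K.
        norm (x - y) \<le> r \<longrightarrow> norm ((T ^^ n) x - (T ^^ n) y) \<le> s"
    using near r \<rho> by simp
  then have "\<forall>\<^sub>F n in sequentially. norm ((T ^^ n) z - z) \<le> q * d"
  proof eventually_elim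
    case (elim n)
    note Tn = elim
    \<comment> \<open>Writing \<open>T\<^sup>i\<^sup>+\<^sup>n x = T\<^sup>n (T\<^sup>i x)\<close>, closeness of \<open>T\<^sup>i x\<close> to \<open>z\<close> is carried over to \<open>T\<^sup>n z\<close>.\<close>
    have both: "\<forall>\<^sub>F i in sequentially. norm ((T ^^ i) x - z) \<le> s \<and> norm ((T ^^ i) x - (T ^^ n) z) \<le> s"
    proof -
      have "\<forall>\<^sub>F i in sequentially. norm ((T ^^ (i + n)) x - (T ^^ n) z) \<le> s"
        using zr
      proof eventually_elim
        case (elim i)
        then show ?case
          using Tn TK[OF x, of i] z(1)
          by (simp add: add.commute[of i n] funpow_add)
      qed
      then have "\<forall>\<^sub>F i in sequentially. norm ((T ^^ i) x - (T ^^ n) z) \<le> s"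
        by (rule eventually_sequentially_seg[THEN iffD1])
      with zr show ?thesis by eventually_elim (use r(2) in auto)
    qed
    show ?case
    proof (rule ccontr)
      assume far: "\<not> ?case"
      from s(3) show False
      proof
        assume lt: "(1 - \<delta>) * s < \<rho>"
        \<comment> \<open>The midpoint of \<open>z\<close> and \<open>T\<^sup>n z\<close> would beat the asymptotic radius \<open>\<rho>\<close>.\<close>
        define m where "m = (z + (T ^^ n) z) /\<^sub>R 2"
        have "(1/2) *\<^sub>R z + (1/2) *\<^sub>R (T ^^ n) z \<in> K"
          using K(1) z(1) TK[OF z(1)] by (intro convexD) auto
        then have "m \<in> K" by (simp add: m_def scaleR_add_right)
        moreover have "\<forall>\<^sub>F i in sequentially. norm ((T ^^ i) x - m) \<le> (1 - \<delta>) * s"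
          using both
        proof eventually_elim
          case (elim i)
          let ?a = "(T ^^ i) x - z" and ?b = "(T ^^ i) x - (T ^^ n) z"
          have "norm ((?a + ?b) /\<^sub>R 2) \<le> (1 - \<delta>) * s"
            using elim far s(1,2) \<rho>(1) by (intro mid) auto
          also have "(?a + ?b) /\<^sub>R 2 = (2 *\<^sub>R (T ^^ i) x) /\<^sub>R 2 - m"
            unfolding m_def scaleR_diff_right[symmetric] by (simp add: scaleR_2)
          finally show ?case by simp
        qed
        ultimately have "(1 - \<delta>) * s \<in> R" unfolding R_def by blast
        then show False using R_lower lt by fastforce
      next
        assume le: "2 * s \<le> q * d"
        obtain i where "norm ((T ^^ i) x - z) \<le> s" "norm ((T ^^ i) x - (T ^^ n) z) \<le> s"
          using both unfolding eventually_sequentially by blast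
        then show False
          using norm_triangle_ineq4[of "(T ^^ i) x - z" "(T ^^ i) x - (T ^^ n) z"] far le by simp
      qed
    qed
  qed
  then show ?thesis using z(1) zx by blast
qed

section \<open>The fixed point\<close>

lemma convergent_if_geometric_increments:
  fixes X :: "nat \<Rightarrow> 'a::banach"
  assumes "\<And>n. norm (X (Suc n) - X n) \<le> C * q ^ n" "\<bar>q\<bar> < 1"
  shows "convergent X"
proof -
  have "summable (\<lambda>n. C * q ^ n)"
    using assms(2) by (intro summable_mult summable_geometric) simp
  then have "summable (\<lambda>n. X (Suc n) - X n)"
    by (rule summable_comparison_test') (rule assms(1))
  then have "convergent (\<lambda>n. X n - X 0)"
    by (simp only: summable_iff_convergent sum_lessThan_telescope)
  then show ?thesis by (simp add: convergent_diff_const_right_iff)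
qed

theorem corollary3p1:
  fixes K :: "'a::banach set" and T :: "'a \<Rightarrow> 'a"
  assumes "characteristic_of_convexity TYPE('a) < 1"
    and "K \<noteq> {}" and "closed K" and "bounded K" and "convex K"
    and "T \<in> K \<rightarrow> K"
    and "asymptotically_hoelder_nonexpansive_on K T"
  shows "\<exists>x\<in>K. T x = x"
proof -
  note near = asymptotically_hoelder_nonexpansive_on_eventually_le[OF assms(7)]
  obtain c where c: "characteristic_of_convexity TYPE('a) < c" "c < 1"
    using dense[OF assms(1)] by blast
  obtain q where q: "c < q" "q < 1" using dense[OF c(2)] by blast
  have "0 < q" using characteristic_of_convexity_nonneg[where 'a='a] c q by linarith
  have TK: "(T ^^ n) y \<in> K" if "y \<in> K" for n y
    using that assms(6) by (induction n) auto
  \<comment> \<open>Boundedness of \<open>K\<close> provides a finite displacement bound to start the iteration from.\<close>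
  obtain x0 where x0: "x0 \<in> K" using assms(2) by blast
  obtain B where B: "B > 0" "\<And>y. y \<in> K \<Longrightarrow> norm y \<le> B"
    using assms(4) unfolding bounded_pos by blast
  define D where "D = 2 * B"
  have D: "D > 0" "\<And>n. norm ((T ^^ n) x0 - x0) \<le> D"
  proof -
    show "D > 0" using B(1) unfolding D_def by simp
    show "norm ((T ^^ n) x0 - x0) \<le> D" for n
      using norm_triangle_ineq4[of "(T ^^ n) x0" x0] B(2)[OF x0] B(2)[OF TK[OF x0, of n]]
      unfolding D_def by linarith
  qed
  have "\<exists>X. \<forall>k. (X k \<in> K \<and> (\<forall>\<^sub>F n in sequentially. norm ((T ^^ n) (X k) - X k) \<le> q ^ k * D))
      \<and> norm (X (Suc k) - X k) \<le> 3 * (q ^ k * D)"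
  proof (rule dependent_nat_choice)
    show "\<exists>x. x \<in> K \<and> (\<forall>\<^sub>F n in sequentially. norm ((T ^^ n) x - x) \<le> q ^ 0 * D)"
      using x0 D by auto
  next
    fix x k assume "x \<in> K \<and> (\<forall>\<^sub>F n in sequentially. norm ((T ^^ n) x - x) \<le> q ^ k * D)"
    then show "\<exists>y. (y \<in> K \<and> (\<forall>\<^sub>F n in sequentially. norm ((T ^^ n) y - y) \<le> q ^ Suc k * D))
        \<and> norm (y - x) \<le> 3 * (q ^ k * D)"
      using asymptotic_displacement_reduction[OF c(1) q assms(5,6) near, of x "q ^ k * D"]
        \<open>0 < q\<close> D(1) by (auto simp: mult.assoc)
  qed
  then obtain X where XK: "\<And>k. X k \<in> K"
    and Xd: "\<And>k. \<forall>\<^sub>F n in sequentially. norm ((T ^^ n) (X k) - X k) \<le> q ^ k * D"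
    and Xs: "\<And>k. norm (X (Suc k) - X k) \<le> 3 * (q ^ k * D)" by blast
  have "convergent X"
    by (rule convergent_if_geometric_increments[where C = "3 * D" and q = q])
      (use Xs \<open>0 < q\<close> q in \<open>auto simp: algebra_simps\<close>)
  then obtain w where Xw: "X \<longlonglongrightarrow> w" unfolding convergent_def by blast
  have w: "w \<in> K" using closed_sequentially[OF assms(3) XK Xw] .
  have Tw: "(\<lambda>n. (T ^^ n) w) \<longlonglongrightarrow> w"
  proof (rule tendstoI)
    fix e :: real assume "e > 0"
    have "(\<lambda>k. q ^ k * D) \<longlonglongrightarrow> 0 * D"
      using \<open>0 < q\<close> q by (intro tendsto_intros LIMSEQ_power_zero) auto
    then have "\<forall>\<^sub>F k in sequentially. q ^ k * D < e / 4"
      using \<open>e > 0\<close> by (intro order_tendstoD) auto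
    moreover have "\<forall>\<^sub>F k in sequentially. dist (X k) w < e / 8"
      using Xw \<open>e > 0\<close> by (intro tendstoD) auto
    ultimately have "\<forall>\<^sub>F k in sequentially. q ^ k * D < e / 4 \<and> dist (X k) w < e / 8"
      by eventually_elim simp
    then obtain k where k: "q ^ k * D < e / 4" "dist (X k) w < e / 8"
      unfolding eventually_sequentially by blast
    have "\<forall>\<^sub>F n in sequentially. \<forall>x\<in>K. \<forall>y\<in>K.
        norm (x - y) \<le> e / 8 \<longrightarrow> norm ((T ^^ n) x - (T ^^ n) y) \<le> e / 4"
      using \<open>e > 0\<close> by (intro near) auto
    then show "\<forall>\<^sub>F n in sequentially. dist ((T ^^ n) w) w < e" using Xd[of k]
    proof eventually_elim
      case (elim n)
      have "dist ((T ^^ n) (X k)) ((T ^^ n) w) \<le> e / 4"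
        using elim(1) XK[of k] w k(2) by (simp add: dist_norm)
      moreover have "dist ((T ^^ n) (X k)) (X k) < e / 4"
        using elim(2) k(1) by (simp add: dist_norm)
      ultimately show ?case
        using k(2) dist_triangle3[of "(T ^^ n) w" w "(T ^^ n) (X k)"]
          dist_triangle[of "(T ^^ n) (X k)" w "X k"] \<open>e > 0\<close> by linarith
    qed
  qed
  have "(\<lambda>n. T ((T ^^ n) w)) \<longlonglongrightarrow> T w"
    using continuous_on_tendsto_compose[OF
        asymptotically_hoelder_nonexpansive_on_continuous[OF assms(7)] Tw w] TK[OF w] by simp
  moreover have "(\<lambda>n. T ((T ^^ n) w)) \<longlonglongrightarrow> w"
    using LIMSEQ_Suc[OF Tw] by simp
  ultimately have "T w = w" by (rule LIMSEQ_unique)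
  then show ?thesis using w by blast
qed

end
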